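(* Let $j,k\ge 4$ and consider the Game of Cycles on the $j$-$2$-$k$ graph. If $j+k$ is odd, Player 1 has a winning strategy; if $j+k$ is even, Player 2 has a winning strategy.
   Context: Game of Cycles: the gameboard is a simple connected graph drawn in the plane without crossings. Players 1 and 2 alternate turns, Player 1 first; on a turn a player must, if possible, direct one currently undirected edge, and it is illegal to create a sink (a vertex all of whose incident edges point into it) or a source (a vertex all of whose incident edges point out of it). A cycle cell is a cycle of the graph bounding a bounded face of the drawing; a player who directs an edge so that all edges of some cycle cell are directed consistently around it wins immediately. Otherwise the player who makes the last legal move wins. A $j$-$2$-$k$ graph consists of two vertices joined by three internally disjoint paths: an upper path with $j$ edges, a middle path with $2$ edges, and a lower path with $k$ edges, all other vertices having degree $2$; it is drawn with the middle path between the upper and lower paths, so its cycle cells are the $(j+2)$-cycle formed by the upper and middle paths and the $(k+2)$-cycle formed by the middle and lower paths. *)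

theory Defs
  imports "Graph_Theory.Graph_Theory"
begin

section \<open>The Game of Cycles\<close>

text \<open>
  A finite simple undirected graph is a symmetric loop-free digraph: the undirected edge
  between \<open>u\<close> and \<open>v\<close> is represented by the two arcs \<open>(u, v)\<close> and \<open>(v, u)\<close>, and directing that
  edge from \<open>u\<close> to \<open>v\<close> means choosing the arc \<open>(u, v)\<close>.  The plane drawing enters the rules
  only through its cycle cells, so it is represented by them.  Every cell is given by listing
  the vertices of its boundary cycle once around (starting point and sense are immaterial).
  The minimal length excludes the degenerate closed walk \<open>u, v, u\<close>.
\<close>

definition boundary_arcs :: "'v list \<Rightarrow> ('v \<times> 'v) list" where
  "boundary_arcs c = zip c (rotate1 c)"

locale gameboard = pair_graph G for G :: "'v pair_pre_digraph" +
  fixes cells :: "'v list set"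
  assumes connected: "connected (with_proj G)"
    and cell_cycle: "c \<in> cells \<Longrightarrow> cycle (boundary_arcs c)"
    and cell_length: "c \<in> cells \<Longrightarrow> 3 \<le> length c"

datatype player = Player1 | Player2

text \<open>The player making the move with index \<open>i\<close> (counted from 0).\<close>

definition mover :: "nat \<Rightarrow> player" where
  "mover i = (if even i then Player1 else Player2)"

context gameboard
begin

text \<open>A position is the set \<open>D\<close> of the arcs chosen so far.\<close>

definition sink :: "('v \<times> 'v) set \<Rightarrow> 'v \<Rightarrow> bool" where
  "sink D v \<longleftrightarrow> v \<in> pverts G \<and> (\<forall>u. (u, v) \<in> parcs G \<longrightarrow> (u, v) \<in> D)"

definition source :: "('v \<times> 'v) set \<Rightarrow> 'v \<Rightarrow> bool" where
  "source D v \<longleftrightarrow> v \<in> pverts G \<and> (\<forall>u. (v, u) \<in> parcs G \<longrightarrow> (v, u) \<in> D)"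

definition legal_move :: "('v \<times> 'v) set \<Rightarrow> 'v \<times> 'v \<Rightarrow> bool" where
  "legal_move D a \<longleftrightarrow> a \<in> parcs G \<and> a \<notin> D \<and> prod.swap a \<notin> D \<and>
     (\<nexists>v. sink (insert a D) v) \<and> (\<nexists>v. source (insert a D) v)"

definition cell_completed :: "('v \<times> 'v) set \<Rightarrow> bool" where
  "cell_completed D \<longleftrightarrow>
     (\<exists>c \<in> cells. set (boundary_arcs c) \<subseteq> D \<or> (set (boundary_arcs c))\<inverse> \<subseteq> D)"

definition game_over :: "('v \<times> 'v) set \<Rightarrow> bool" where
  "game_over D \<longleftrightarrow> cell_completed D \<or> (\<nexists>a. legal_move D a)"

text \<open>A (possibly unfinished) play is the chronological list of the moves made.\<close>

definition is_play :: "('v \<times> 'v) list \<Rightarrow> bool" where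
  "is_play ms \<longleftrightarrow> (\<forall>i < length ms.
     \<not> game_over (set (take i ms)) \<and> legal_move (set (take i ms)) (ms ! i))"

text \<open>
  Completing a cell ends the play at once.  Hence both winning conditions (completing a cell;
  otherwise, making the last legal move) say that the maker of the last move of a finished
  play wins.
\<close>

definition wins :: "player \<Rightarrow> ('v \<times> 'v) list \<Rightarrow> bool" where
  "wins p ms \<longleftrightarrow> game_over (set ms) \<and> ms \<noteq> [] \<and> mover (length ms - 1) = p"

text \<open>A strategy maps the history of the play to the next move.\<close>

definition follows ::
    "(('v \<times> 'v) list \<Rightarrow> 'v \<times> 'v) \<Rightarrow> player \<Rightarrow> ('v \<times> 'v) list \<Rightarrow> bool" where
  "follows \<sigma> p ms \<longleftrightarrow> (\<forall>i < length ms. mover i = p \<longrightarrow> ms ! i = \<sigma> (take i ms))"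

text \<open>
  The first conjunct makes the strategy prescribe a legal move whenever it has to; without it
  a strategy could win vacuously by prescribing illegal moves.  Plays are finite because every
  move directs a new edge.
\<close>

definition winning_strategy ::
    "player \<Rightarrow> (('v \<times> 'v) list \<Rightarrow> 'v \<times> 'v) \<Rightarrow> bool" where
  "winning_strategy p \<sigma> \<longleftrightarrow> (\<forall>ms. is_play ms \<and> follows \<sigma> p ms \<longrightarrow>
     (\<not> game_over (set ms) \<and> mover (length ms) = p \<longrightarrow> legal_move (set ms) (\<sigma> ms)) \<and>
     (game_over (set ms) \<longrightarrow> wins p ms))"

definition has_winning_strategy :: "player \<Rightarrow> bool" where
  "has_winning_strategy p \<longleftrightarrow> (\<exists>\<sigma>. winning_strategy p \<sigma>)"

end


section \<open>The \<open>j\<close>-2-\<open>k\<close> graph\<close>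

datatype j2k_vertex = Left_End | Right_End | Mid | Up nat | Low nat

definition upper_path :: "nat \<Rightarrow> j2k_vertex list" where
  "upper_path j = Left_End # map Up [1..<j] @ [Right_End]"

definition middle_path :: "j2k_vertex list" where
  "middle_path = [Left_End, Mid, Right_End]"

definition lower_path :: "nat \<Rightarrow> j2k_vertex list" where
  "lower_path k = Left_End # map Low [1..<k] @ [Right_End]"

definition path_arcs :: "'v list \<Rightarrow> ('v \<times> 'v) set" where
  "path_arcs xs = set (zip (butlast xs) (tl xs))"

definition j2k_graph :: "nat \<Rightarrow> nat \<Rightarrow> j2k_vertex pair_pre_digraph" where
  "j2k_graph j k =
     (let A = path_arcs (upper_path j) \<union> path_arcs middle_path \<union> path_arcs (lower_path k)
      in \<lparr> pverts = set (upper_path j) \<union> set middle_path \<union> set (lower_path k),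
           parcs = A \<union> A\<inverse> \<rparr>)"

text \<open>
  Each of the two cells is traversed along the upper, resp. lower, path from \<open>Left_End\<close> to
  \<open>Right_End\<close> and back through \<open>Mid\<close>.
\<close>

definition j2k_cells :: "nat \<Rightarrow> nat \<Rightarrow> j2k_vertex list set" where
  "j2k_cells j k = {upper_path j @ [Mid], lower_path k @ [Mid]}"


subsection \<open>Well-formedness\<close>

lemma length_paths:
  "1 \<le> j \<Longrightarrow> length (upper_path j) = j + 1"
  "1 \<le> k \<Longrightarrow> length (lower_path k) = k + 1"
  "length middle_path = 2 + 1"
  by (simp_all add: upper_path_def lower_path_def middle_path_def)

lemma distinct_paths:
  "distinct (upper_path j)" "distinct (lower_path k)" "distinct middle_path"
  by (auto simp: upper_path_def lower_path_def middle_path_def distinct_map inj_on_def)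

lemma paths_internally_disjoint:
  "set (upper_path j) \<inter> set (lower_path k) = {Left_End, Right_End}"
  "set (upper_path j) \<inter> set middle_path = {Left_End, Right_End}"
  "set middle_path \<inter> set (lower_path k) = {Left_End, Right_End}"
  by (auto simp: upper_path_def lower_path_def middle_path_def)

lemma path_arcs_Cons: "path_arcs (x # y # xs) = insert (x, y) (path_arcs (y # xs))"
  by (simp add: path_arcs_def)

lemma path_arcs_single: "path_arcs [x] = {}"
  by (simp add: path_arcs_def)

lemma path_arcs_subset: "path_arcs xs \<subseteq> set xs \<times> set xs"
proof (induction xs rule: induct_list012)
  case (3 y z zs)
  then show ?case by (auto simp: path_arcs_Cons)
qed (simp_all add: path_arcs_def)

lemma path_arcs_no_loop: "distinct xs \<Longrightarrow> (x, x) \<notin> path_arcs xs"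
proof (induction xs rule: induct_list012)
  case (3 y z zs)
  then show ?case by (auto simp: path_arcs_Cons)
qed (simp_all add: path_arcs_def)

lemma boundary_arcs_append:
  assumes "xs \<noteq> []"
  shows "set (boundary_arcs (xs @ [m])) = path_arcs (xs @ [m, hd xs])"
proof -
  obtain y ys where xs: "xs = y # ys" using assms by (cases xs) auto
  show ?thesis unfolding boundary_arcs_def path_arcs_def xs
    by (simp add: butlast_append)
qed

lemma path_arcs_append:
  assumes "xs \<noteq> []"
  shows "path_arcs (xs @ y # ys) = path_arcs xs \<union> insert (last xs, y) (path_arcs (y # ys))"
  using assms
proof (induction xs rule: induct_list012)
  case (3 a b zs)
  then show ?case by (simp add: path_arcs_Cons insert_commute)
qed (simp_all add: path_arcs_Cons path_arcs_single)

lemma pair_graph_j2k: "pair_graph (j2k_graph j k)"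
proof
  fix e assume e: "e \<in> parcs (j2k_graph j k)"
  show "fst e \<in> pverts (j2k_graph j k)" "snd e \<in> pverts (j2k_graph j k)"
    using e path_arcs_subset[of "upper_path j"] path_arcs_subset[of "lower_path k"]
      path_arcs_subset[of middle_path]
    by (auto simp: j2k_graph_def Let_def)
  show "fst e \<noteq> snd e"
    using e path_arcs_no_loop[OF distinct_paths(1)] path_arcs_no_loop[OF distinct_paths(2)]
      path_arcs_no_loop[OF distinct_paths(3)]
    by (cases e) (auto simp: j2k_graph_def Let_def)
next
  show "finite (pverts (j2k_graph j k))" "finite (parcs (j2k_graph j k))"
    by (auto simp: j2k_graph_def Let_def path_arcs_def)
  show "symmetric (with_proj (j2k_graph j k))"
    by (auto simp: symmetric_def sym_def j2k_graph_def Let_def)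
qed

lemma (in pair_graph) path_reachable:
  assumes "path_arcs xs \<subseteq> parcs G" "set xs \<subseteq> pverts G" "x \<in> set xs"
  shows "hd xs \<rightarrow>\<^sup>*\<^bsub>with_proj G\<^esub> x"
  using assms
proof (induction xs rule: induct_list012)
  case (3 y z zs)
  have yz: "y \<rightarrow>\<^bsub>with_proj G\<^esub> z" using 3(3) by (simp add: path_arcs_Cons)
  show ?case
  proof (cases "x = y")
    case True
    then show ?thesis using 3 by (simp add: reachable_refl)
  next
    case False
    then have "z \<rightarrow>\<^sup>*\<^bsub>with_proj G\<^esub> x" using 3 by (simp add: path_arcs_Cons)
    then show ?thesis using yz by (simp add: adj_reachable_trans)
  qed
qed auto

lemma connected_j2k: "connected (with_proj (j2k_graph j k))"
proof -
  interpret pair_graph "j2k_graph j k" by (rule pair_graph_j2k)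
  let ?G = "with_proj (j2k_graph j k)"
  have reach: "Left_End \<rightarrow>\<^sup>*\<^bsub>?G\<^esub> x" if "x \<in> pverts (j2k_graph j k)" for x
  proof -
    have "hd (upper_path j) \<rightarrow>\<^sup>*\<^bsub>?G\<^esub> x" if "x \<in> set (upper_path j)"
      by (rule path_reachable[OF _ _ that]) (auto simp: j2k_graph_def Let_def)
    moreover have "hd (lower_path k) \<rightarrow>\<^sup>*\<^bsub>?G\<^esub> x" if "x \<in> set (lower_path k)"
      by (rule path_reachable[OF _ _ that]) (auto simp: j2k_graph_def Let_def)
    moreover have "hd middle_path \<rightarrow>\<^sup>*\<^bsub>?G\<^esub> x" if "x \<in> set middle_path"
      by (rule path_reachable[OF _ _ that]) (auto simp: j2k_graph_def Let_def)
    ultimately show ?thesis using that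
      by (auto simp: j2k_graph_def Let_def upper_path_def lower_path_def middle_path_def)
  qed
  show ?thesis
  proof (rule connectedI)
    show "pverts (j2k_graph j k) \<noteq> {}" by (simp add: j2k_graph_def Let_def middle_path_def)
  next
    fix u v assume "u \<in> pverts (j2k_graph j k)" "v \<in> pverts (j2k_graph j k)"
    then have "u \<rightarrow>\<^sup>*\<^bsub>?G\<^esub> v"
      using reach[of u] reach[of v] symmetric_reachable[OF sym_arcs]
      by (auto intro: reachable_trans)
    then show "u \<rightarrow>\<^sup>*\<^bsub>with_proj (mk_symmetric ?G)\<^esub> v" by (rule reachable_mk_symmetricI)
  qed
qed

lemma pcas_zip: "pcas x (zip (x # xs) (xs @ [y])) y"
  by (induction xs arbitrary: x) auto

lemma pawalk_verts_zip: "pawalk_verts x (zip (x # xs) (xs @ [y])) = x # xs @ [y]"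
  by (induction xs arbitrary: x) auto

lemma (in pair_graph) cycle_boundary_arcs:
  assumes "distinct c" "c \<noteq> []" "set (boundary_arcs c) \<subseteq> parcs G" "set c \<subseteq> pverts G"
  shows "cycle (boundary_arcs c)"
proof -
  obtain x xs where c: "c = x # xs" using assms(2) by (cases c) auto
  have b: "boundary_arcs c = zip (x # xs) (xs @ [x])" by (simp add: boundary_arcs_def c)
  have "awalk x (boundary_arcs c) x"
    using assms pcas_zip[of x xs x] unfolding awalk_def b by (simp add: c)
  moreover have "distinct (tl (pawalk_verts x (boundary_arcs c)))"
    using assms(1) unfolding b pawalk_verts_zip by (simp add: c)
  moreover have "boundary_arcs c \<noteq> []" by (cases xs) (simp_all add: b)
  ultimately show ?thesis unfolding cycle_def by blast
qed

theorem gameboard_j2k: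
  assumes "1 \<le> j" "1 \<le> k"
  shows "gameboard (j2k_graph j k) (j2k_cells j k)"
proof -
  interpret pair_graph "j2k_graph j k" by (rule pair_graph_j2k)
  show ?thesis
  proof
    show "connected (with_proj (j2k_graph j k))" by (rule connected_j2k)
  next
    fix c assume c: "c \<in> j2k_cells j k"
    show "3 \<le> length c" using c assms by (auto simp: j2k_cells_def length_paths)
    show "cycle (boundary_arcs c)"
    proof (rule cycle_boundary_arcs)
      show "distinct c" using c distinct_paths
        by (auto simp: j2k_cells_def upper_path_def lower_path_def)
      show "c \<noteq> []" using c by (auto simp: j2k_cells_def)
      show "set c \<subseteq> pverts (j2k_graph j k)" using c
        by (auto simp: j2k_cells_def j2k_graph_def Let_def middle_path_def)
      have ne: "upper_path j \<noteq> []" "lower_path k \<noteq> []"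
        and ends: "hd (upper_path j) = Left_End" "last (upper_path j) = Right_End"
          "hd (lower_path k) = Left_End" "last (lower_path k) = Right_End"
        by (simp_all add: upper_path_def lower_path_def)
      show "set (boundary_arcs c) \<subseteq> parcs (j2k_graph j k)" using c
        by (auto simp: j2k_cells_def boundary_arcs_append ne path_arcs_append ends
            path_arcs_Cons path_arcs_single j2k_graph_def Let_def middle_path_def)
    qed
  qed
qed

end

theory Submission
  imports Defs
begin

text \<open>
  Fix a flow direction \<open>d\<close> along the three branches.  If two edges at the left end and two edges
  at the right end flow along \<open>d\<close>, then any position without legal moves has an even number of
  unmarked edges: in a stuck position every unmarked edge switches the flow along its branch, and
  each of the two ends carries exactly one branch flowing against \<open>d\<close>.  So the player favoured by
  the parity of \<open>j + k\<close> first gets a middle edge flowing along \<open>d\<close> and then secures an upper or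
  lower edge along \<open>d\<close> at each end; there are two candidates per end, and as \<open>j, k \<ge> 4\<close> a single
  move of the opponent spoils at most one candidate at one end.  The secured edges rule out one of
  the two cells, and the parity then also provides moves that never let the opponent complete the
  other one.
\<close>

section \<open>Strategies from invariants\<close>

context gameboard
begin

text \<open>Sinks and sources survive the addition of arcs. Used to play ahead of time a move found
  in a later position.\<close>

lemma legal_move_antimono:
  assumes "legal_move D' a" "D \<subseteq> D'"
  shows "legal_move D a"
  using assms unfolding legal_move_def sink_def source_def by blast

lemma is_play_snoc:
  "is_play (ms @ [m]) \<longleftrightarrow> is_play ms \<and> \<not> game_over (set ms) \<and> legal_move (set ms) m"
  unfolding is_play_def length_append_singleton All_less_Suc
  by (auto simp: nth_append)

lemma follows_snoc:
  "follows \<sigma> p (ms @ [m]) \<longleftrightarrow> follows \<sigma> p ms \<and> (mover (length ms) = p \<longrightarrow> m = \<sigma> ms)"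
  unfolding follows_def length_append_singleton All_less_Suc
  by (auto simp: nth_append)

text \<open>\<open>I\<close> collects the positions that \<open>p\<close> leaves to the opponent. As
  the maker of the last move wins, it suffices that the opponent never completes a cell and that
  \<open>p\<close> always has an answer.\<close>

lemma winning_strategy_from_invariant:
  assumes step: "\<And>D a. D \<in> I \<Longrightarrow> legal_move D a \<Longrightarrow> \<not> cell_completed (insert a D) \<and>
      (\<exists>b. legal_move (insert a D) b \<and>
        (cell_completed (insert b (insert a D)) \<or> insert b (insert a D) \<in> I))"
    and start1: "p = Player1 \<Longrightarrow> \<not> cell_completed {} \<and> (\<exists>a. legal_move {} a \<and> {a} \<in> I)"
    and start2: "p = Player2 \<Longrightarrow> \<not> game_over {} \<and> {} \<in> I"
  shows "has_winning_strategy p"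
proof -
  define good where "good D b \<longleftrightarrow>
    legal_move D b \<and> (cell_completed (insert b D) \<or> insert b D \<in> I)" for D b
  define \<sigma> where "\<sigma> ms = (SOME b. good (set ms) b)" for ms
  \<comment> \<open>On the opponent's turn a completed cell means that \<open>p\<close> has just
    won; any continuation of the play therefore starts in \<open>I\<close>.\<close>
  have inv: "if mover (length ms) = p then \<not> cell_completed (set ms) \<and> (\<exists>b. good (set ms) b)
      else cell_completed (set ms) \<or> set ms \<in> I"
    if "is_play ms" "follows \<sigma> p ms" for ms
    using that
  proof (induction ms rule: rev_induct)
    case Nil
    then show ?case using start1 start2 by (cases p) (auto simp: mover_def good_def)
  next
    case (snoc m ms)
    have play: "is_play ms" "\<not> game_over (set ms)" "legal_move (set ms) m"
      using snoc.prems(1) unfolding is_play_snoc by auto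
    have fol: "follows \<sigma> p ms" "mover (length ms) = p \<Longrightarrow> m = \<sigma> ms"
      using snoc.prems(2) unfolding follows_snoc by auto
    note IH = snoc.IH[OF play(1) fol(1)]
    show ?case
    proof (cases "mover (length ms) = p")
      case True
      then have "good (set ms) m"
        using IH fol(2) unfolding \<sigma>_def by (metis someI_ex)
      moreover have "mover (length (ms @ [m])) \<noteq> p" using True by (auto simp: mover_def)
      ultimately show ?thesis by (auto simp: good_def)
    next
      case False
      then have "mover (length (ms @ [m])) = p" by (cases p) (auto simp: mover_def split: if_splits)
      moreover have "set ms \<in> I" using IH False play(2) by (auto simp: game_over_def)
      ultimately show ?thesis using step[OF _ play(3)] by (auto simp: good_def)
    qed
  qed
  have "winning_strategy p \<sigma>"
    unfolding winning_strategy_def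
  proof (intro allI impI, elim conjE, intro conjI impI)
    fix ms assume ms: "is_play ms" "follows \<sigma> p ms"
    {
      assume "\<not> game_over (set ms) \<and> mover (length ms) = p"
      then show "legal_move (set ms) (\<sigma> ms)"
        using inv[OF ms] unfolding \<sigma>_def by (metis good_def someI_ex)
    next
      assume over: "game_over (set ms)"
      then have turn: "mover (length ms) \<noteq> p"
        using inv[OF ms] by (auto simp: game_over_def good_def)
      \<comment> \<open>At the empty play Player 1 is to move, so only \<open>p = Player2\<close>
        remains, and \<open>start2\<close> excludes a finished board there.\<close>
      then have ne: "ms \<noteq> []"
        using over start2 by (cases p) (auto simp: mover_def)
      have "mover (length ms - 1) = p"
        using turn ne by (cases p) (auto simp: mover_def split: if_splits)
      then show "wins p ms" using over ne by (simp add: wins_def)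
    }
  qed
  then show ?thesis by (auto simp: has_winning_strategy_def)
qed

end

section \<open>Coordinates on the \<open>j\<close>-2-\<open>k\<close> graph\<close>

datatype branch = Upper | Middle | Lower

lemma UNIV_branch: "UNIV = {Upper, Middle, Lower}"
  using branch.exhaust by auto

lemma ex_branch: "(\<exists>p. P p) \<longleftrightarrow> P Upper \<or> P Middle \<or> P Lower"
  by (metis branch.exhaust)

locale j2k_game =
  fixes j k :: nat
  assumes j4: "4 \<le> j" and k4: "4 \<le> k"
begin

sublocale gameboard "j2k_graph j k" "j2k_cells j k"
  using gameboard_j2k j4 k4 by simp

fun len :: "branch \<Rightarrow> nat" where
  "len Upper = j" | "len Middle = 2" | "len Lower = k"

definition vert :: "branch \<Rightarrow> nat \<Rightarrow> j2k_vertex" where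
  "vert p i = (if i = 0 then Left_End else if i = len p then Right_End
     else case p of Upper \<Rightarrow> Up i | Middle \<Rightarrow> Mid | Lower \<Rightarrow> Low i)"

text \<open>The flag records whether the edge is directed towards the right end.\<close>

definition dart :: "branch \<Rightarrow> nat \<Rightarrow> bool \<Rightarrow> j2k_vertex \<times> j2k_vertex" where
  "dart p i d = (if d then (vert p i, vert p (Suc i)) else (vert p (Suc i), vert p i))"

lemma len_ge: "2 \<le> len p" "p \<noteq> Middle \<Longrightarrow> 4 \<le> len p"
  using j4 k4 by (cases p; simp)+

lemma len_pos [simp]: "0 < len p"
  using len_ge(1)[of p] by simp

lemma vert_eq_iff:
  assumes "i \<le> len p" "l \<le> len q"
  shows "vert p i = vert q l \<longleftrightarrow> (i = 0 \<and> l = 0) \<or> (i = len p \<and> l = len q) \<or> (p = q \<and> i = l)"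
  using assms len_ge(1)[of p] len_ge(1)[of q]
  by (auto simp: vert_def split: branch.splits if_splits)

lemma dart_eq_iff [simp]:
  assumes "i < len p" "l < len q"
  shows "dart p i d = dart q l e \<longleftrightarrow> p = q \<and> i = l \<and> d = e"
  using assms len_ge(1)[of p] len_ge(1)[of q]
  by (auto simp: dart_def vert_eq_iff)

lemma swap_dart [simp]: "prod.swap (dart p i d) = dart p i (\<not> d)"
  by (simp add: dart_def)

lemma path_nth:
  "i \<le> j \<Longrightarrow> upper_path j ! i = vert Upper i"
  "i \<le> 2 \<Longrightarrow> middle_path ! i = vert Middle i"
  "i \<le> k \<Longrightarrow> lower_path k ! i = vert Lower i"
  using j4 k4
  by (auto simp: upper_path_def middle_path_def lower_path_def vert_def nth_Cons' nth_append
      le_Suc_eq numeral_2_eq_2)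

lemma path_arcs_nth: "path_arcs xs = {(xs ! i, xs ! Suc i) | i. Suc i < length xs}"
  unfolding path_arcs_def set_conv_nth
  by (rule Collect_cong, rule ex_cong1) (auto simp: nth_butlast nth_tl)

lemma path_arcs_vert:
  assumes "length xs = len p + 1" "\<And>i. i \<le> len p \<Longrightarrow> xs ! i = vert p i"
  shows "path_arcs xs = {dart p i True | i. i < len p}"
  unfolding path_arcs_nth using assms
  by (intro Collect_cong ex_cong1) (auto simp: dart_def)

lemma path_arcs_branch:
  "path_arcs (upper_path j) = {dart Upper i True | i. i < len Upper}"
  "path_arcs middle_path = {dart Middle i True | i. i < len Middle}"
  "path_arcs (lower_path k) = {dart Lower i True | i. i < len Lower}"
  using j4 k4 by (intro path_arcs_vert; simp add: length_paths path_nth)+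

lemma parcs_j2k: "parcs (j2k_graph j k) = {dart p i d | p i d. i < len p}"
proof -
  let ?A = "\<lambda>d. {dart p i d | p i. i < len p}"
  have "?A True = path_arcs (upper_path j) \<union> path_arcs middle_path \<union> path_arcs (lower_path k)"
    unfolding path_arcs_branch ex_branch by auto
  moreover have "(?A True)\<inverse> = ?A False" by (auto simp: dart_def)
  ultimately have "parcs (j2k_graph j k) = ?A True \<union> ?A False"
    by (simp add: j2k_graph_def Let_def)
  also have "\<dots> = {dart p i d | p i d. i < len p}"
    by (rule set_eqI) (simp only: Un_iff mem_Collect_eq ex_bool_eq, blast)
  finally show ?thesis .
qed

lemma set_vert:
  assumes "length xs = len p + 1" "\<And>i. i \<le> len p \<Longrightarrow> xs ! i = vert p i"
  shows "set xs = {vert p i | i. i \<le> len p}"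
  unfolding set_conv_nth using assms
  by (intro Collect_cong ex_cong1) auto

lemma pverts_j2k: "pverts (j2k_graph j k) = {vert p i | p i. i \<le> len p}"
proof -
  have "set (upper_path j) = {vert Upper i | i. i \<le> len Upper}"
    "set middle_path = {vert Middle i | i. i \<le> len Middle}"
    "set (lower_path k) = {vert Lower i | i. i \<le> len Lower}"
    using j4 k4 by (intro set_vert; simp add: length_paths path_nth)+
  then have "pverts (j2k_graph j k) = {vert Upper i | i. i \<le> len Upper} \<union>
      {vert Middle i | i. i \<le> len Middle} \<union> {vert Lower i | i. i \<le> len Lower}"
    by (simp add: j2k_graph_def Let_def)
  then show ?thesis unfolding ex_branch by auto
qed

text \<open>Going around a cell, the middle path is run against the outer branch, hence the negated
  flags; \<open>d\<close> is the sense of rotation.\<close>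

definition cell_arcs :: "branch \<Rightarrow> bool \<Rightarrow> (j2k_vertex \<times> j2k_vertex) set" where
  "cell_arcs p d = {dart p i d | i. i < len p} \<union> {dart Middle 0 (\<not> d), dart Middle 1 (\<not> d)}"

lemma cell_completed_iff: "cell_completed D \<longleftrightarrow> (\<exists>p d. p \<noteq> Middle \<and> cell_arcs p d \<subseteq> D)"
proof -
  have ne: "upper_path j \<noteq> []" "lower_path k \<noteq> []"
    and ends: "hd (upper_path j) = Left_End" "last (upper_path j) = Right_End"
      "hd (lower_path k) = Left_End" "last (lower_path k) = Right_End"
    by (simp_all add: upper_path_def lower_path_def)
  have mid: "dart Middle 0 False = (Mid, Left_End)" "dart Middle (Suc 0) False = (Right_End, Mid)"
    by (simp_all add: dart_def vert_def)
  have b: "set (boundary_arcs (upper_path j @ [Mid])) = cell_arcs Upper True"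
    "set (boundary_arcs (lower_path k @ [Mid])) = cell_arcs Lower True"
    by (simp_all add: boundary_arcs_append ne path_arcs_append ends path_arcs_Cons
        path_arcs_single path_arcs_branch cell_arcs_def mid insert_commute)
  have c: "(cell_arcs p True)\<inverse> = cell_arcs p False" for p
    by (auto simp: cell_arcs_def dart_def)
  show ?thesis
    unfolding cell_completed_def unfolding j2k_cells_def
    by (simp add: b c ex_branch ex_bool_eq)
qed

section \<open>Sinks and sources in coordinates\<close>

text \<open>The end edges of a branch: \<open>s\<close> holds for the left end.\<close>

definition near :: "bool \<Rightarrow> branch \<Rightarrow> nat" where
  "near s p = (if s then 0 else len p - 1)"

definition second :: "bool \<Rightarrow> branch \<Rightarrow> nat" where
  "second s p = (if s then 1 else len p - 2)"

lemma near_less [simp]: "near s p < len p" and second_less [simp]: "second s p < len p"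
  using len_ge(1)[of p] by (auto simp: near_def second_def)

text \<open>Absence of sinks and sources: an interior vertex is bad when its two edges flow
  oppositely along the branch, an end when all three branches flow the same way there.\<close>

definition stable :: "(j2k_vertex \<times> j2k_vertex) set \<Rightarrow> bool" where
  "stable D \<longleftrightarrow> (\<forall>p i d. Suc i < len p \<longrightarrow> \<not> (dart p i d \<in> D \<and> dart p (Suc i) (\<not> d) \<in> D)) \<and>
     (\<forall>s d. \<exists>p. dart p (near s p) d \<notin> D)"


text \<open>All edges at \<open>v\<close> point into \<open>v\<close> (for \<open>e\<close>), respectively out of \<open>v\<close> (for \<open>\<not> e\<close>).\<close>

definition saturated :: "bool \<Rightarrow> (j2k_vertex \<times> j2k_vertex) set \<Rightarrow> j2k_vertex \<Rightarrow> bool" where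
  "saturated e D v \<longleftrightarrow> v \<in> pverts (j2k_graph j k) \<and>
     (\<forall>p i d. i < len p \<longrightarrow> vert p (if d = e then Suc i else i) = v \<longrightarrow> dart p i d \<in> D)"

lemma sink_iff_saturated: "sink D v \<longleftrightarrow> saturated True D v"
proof -
  have "(\<forall>u. (u, v) \<in> parcs (j2k_graph j k) \<longrightarrow> (u, v) \<in> D) \<longleftrightarrow>
      (\<forall>a \<in> parcs (j2k_graph j k). snd a = v \<longrightarrow> a \<in> D)" by force
  also have "\<dots> \<longleftrightarrow> (\<forall>p i d. i < len p \<longrightarrow> snd (dart p i d) = v \<longrightarrow> dart p i d \<in> D)"
    unfolding parcs_j2k by blast
  finally show ?thesis by (simp add: sink_def saturated_def dart_def if_distrib cong: if_cong)
qed

lemma source_iff_saturated: "source D v \<longleftrightarrow> saturated False D v"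
proof -
  have "(\<forall>u. (v, u) \<in> parcs (j2k_graph j k) \<longrightarrow> (v, u) \<in> D) \<longleftrightarrow>
      (\<forall>a \<in> parcs (j2k_graph j k). fst a = v \<longrightarrow> a \<in> D)" by force
  also have "\<dots> \<longleftrightarrow> (\<forall>p i d. i < len p \<longrightarrow> fst (dart p i d) = v \<longrightarrow> dart p i d \<in> D)"
    unfolding parcs_j2k by blast
  finally show ?thesis by (simp add: source_def saturated_def dart_def if_distrib cong: if_cong)
qed

lemma saturated_left: "saturated e D (vert p 0) \<longleftrightarrow> (\<forall>q. dart q 0 (\<not> e) \<in> D)"
proof -
  have "vert q (if d = e then Suc i else i) = vert p 0 \<longleftrightarrow> i = 0 \<and> d = (\<not> e)"
    if "i < len q" for q i d
    using that by (auto simp: vert_eq_iff)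
  then show ?thesis unfolding saturated_def pverts_j2k by auto
qed

lemma saturated_right: "saturated e D (vert p (len p)) \<longleftrightarrow> (\<forall>q. dart q (len q - 1) e \<in> D)"
proof -
  have "vert q (if d = e then Suc i else i) = vert p (len p) \<longleftrightarrow> i = len q - 1 \<and> d = e"
    if "i < len q" for q i d
    using that len_pos[of q] len_pos[of p] by (auto simp: vert_eq_iff simp del: len_pos)
  then show ?thesis unfolding saturated_def pverts_j2k by auto
qed

lemma saturated_interior:
  assumes "Suc i < len p"
  shows "saturated e D (vert p (Suc i)) \<longleftrightarrow> dart p i e \<in> D \<and> dart p (Suc i) (\<not> e) \<in> D"
proof -
  have "vert q (if d = e then Suc l else l) = vert p (Suc i) \<longleftrightarrow>
      q = p \<and> (if d = e then l = i else l = Suc i)" if "l < len q" for q l d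
    using that assms by (auto simp: vert_eq_iff)
  moreover have "vert p (Suc i) \<in> pverts (j2k_graph j k)"
    using assms unfolding pverts_j2k by (blast intro: less_imp_le)
  ultimately have "saturated e D (vert p (Suc i)) \<longleftrightarrow>
      (\<forall>q l d. l < len q \<longrightarrow> q = p \<and> (if d = e then l = i else l = Suc i) \<longrightarrow> dart q l d \<in> D)"
    by (simp add: saturated_def)
  also have "\<dots> \<longleftrightarrow> dart p i e \<in> D \<and> dart p (Suc i) (\<not> e) \<in> D"
    using assms Suc_lessD[OF assms] by (cases e; simp add: all_bool_eq; blast)
  finally show ?thesis .
qed

lemma stable_iff: "(\<nexists>v. sink D v) \<and> (\<nexists>v. source D v) \<longleftrightarrow> stable D"
proof -
  have "(\<nexists>v. sink D v) \<and> (\<nexists>v. source D v) \<longleftrightarrow> (\<nexists>e v. saturated e D v)"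
    by (simp add: sink_iff_saturated source_iff_saturated ex_bool_eq)
  also have "\<dots> \<longleftrightarrow> (\<nexists>e p i. i \<le> len p \<and> saturated e D (vert p i))"
    unfolding saturated_def pverts_j2k by blast
  \<comment> \<open>All branches share their two end vertices, so \<open>Upper\<close> can represent
    both.\<close>
  also have "\<dots> \<longleftrightarrow> (\<nexists>e. saturated e D (vert Upper 0)) \<and>
      (\<nexists>e. saturated e D (vert Upper (len Upper))) \<and>
      (\<nexists>e p i. Suc i < len p \<and> saturated e D (vert p (Suc i)))"
  proof -
    have "saturated e D (vert p i) \<longleftrightarrow> saturated e D (vert Upper 0)" if "i = 0" for e p i
      by (simp only: that saturated_left)
    moreover have "saturated e D (vert p i) \<longleftrightarrow> saturated e D (vert Upper (len Upper))"
      if "i = len p" for e p i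
      by (simp only: that saturated_right)
    moreover have "i = 0 \<or> i = len p \<or> (\<exists>l. i = Suc l \<and> Suc l < len p)" if "i \<le> len p" for p i
      using that by (cases i) auto
    ultimately show ?thesis by (metis le_refl less_imp_le zero_le)
  qed
  also have "\<dots> \<longleftrightarrow> stable D"
    unfolding stable_def near_def
    by (simp add: saturated_left saturated_right saturated_interior all_bool_eq del: len.simps) blast
  finally show ?thesis .
qed

end

section \<open>Parity of stuck positions\<close>

context j2k_game
begin

text \<open>Properties of the empty board preserved by every legal move; they stand in for
  reachability.\<close>

definition position :: "(j2k_vertex \<times> j2k_vertex) set \<Rightarrow> bool" where
  "position D \<longleftrightarrow> D \<subseteq> parcs (j2k_graph j k) \<and>
     (\<forall>p i d. i < len p \<longrightarrow> dart p i d \<in> D \<longrightarrow> dart p i (\<not> d) \<notin> D) \<and> stable D"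

lemma positionD:
  assumes "position D"
  shows "i < len p \<Longrightarrow> dart p i d \<in> D \<Longrightarrow> dart p i (\<not> d) \<notin> D"
    "Suc i < len p \<Longrightarrow> dart p i d \<in> D \<Longrightarrow> dart p (Suc i) (\<not> d) \<notin> D"
    "\<exists>p. dart p (near s p) d \<notin> D"
  using assms unfolding position_def stable_def by blast+

lemma position_empty: "position {}"
  by (simp add: position_def stable_def)

lemma near_conv:
  "i < len p \<Longrightarrow> i = near s p \<longleftrightarrow> (if s then i = 0 else Suc i = len p)"
  by (auto simp: near_def)

lemma legal_moveE:
  assumes "legal_move D a"
  obtains p i d where "i < len p" "a = dart p i d"
  using assms unfolding legal_move_def parcs_j2k by blast

lemma legal_move_iff_stable:
  assumes "i < len p"
  shows "legal_move D (dart p i d) \<longleftrightarrow>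
    dart p i d \<notin> D \<and> dart p i (\<not> d) \<notin> D \<and> stable (insert (dart p i d) D)"
  using assms unfolding legal_move_def stable_iff[symmetric] parcs_j2k by auto

lemma position_insert:
  assumes "position D" "legal_move D a"
  shows "position (insert a D)"
proof -
  obtain p i d where a: "i < len p" "a = dart p i d" using assms(2) by (rule legal_moveE)
  have l: "stable (insert (dart p i d) D)"
    using assms(2) unfolding a(2) legal_move_iff_stable[OF a(1)] by auto
  have un: "dart p i e \<notin> D" for e
    using assms(2) unfolding a(2) legal_move_iff_stable[OF a(1)] by (cases "e = d") auto
  have "dart q m (\<not> e) \<notin> insert a D" if "m < len q" "dart q m e \<in> insert a D" for q m e
    using that un positionD(1)[OF assms(1), of m q e] a by auto
  moreover have "a \<in> parcs (j2k_graph j k)" using a by (auto simp: parcs_j2k)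
  ultimately show ?thesis using assms(1) l a(2) unfolding position_def by simp
qed

text \<open>\<open>D\<close> is already stable, so only the two vertices of the new edge need
  checking: a neighbouring edge must not flow against it, and at an end some other branch must not
  flow along \<open>d\<close>.\<close>

lemma legal_move_iff:
  assumes "position D" "i < len p"
  shows "legal_move D (dart p i d) \<longleftrightarrow> dart p i d \<notin> D \<and> dart p i (\<not> d) \<notin> D \<and>
    (Suc i < len p \<longrightarrow> dart p (Suc i) (\<not> d) \<notin> D) \<and>
    (0 < i \<longrightarrow> dart p (i - 1) (\<not> d) \<notin> D) \<and>
    (\<forall>s. i = near s p \<longrightarrow> (\<exists>q. q \<noteq> p \<and> dart q (near s q) d \<notin> D))"
    (is "_ \<longleftrightarrow> _ \<and> _ \<and> ?N")
proof -
  let ?E = "insert (dart p i d) D"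
  have "stable ?E \<longleftrightarrow> ?N"
  proof
    assume st: "stable ?E"
    have flow: "dart q (Suc l) (\<not> e) \<notin> ?E"
      if "Suc l < len q" "dart q l e \<in> ?E" for q l e
      using st that unfolding stable_def by blast
    have "\<exists>q. q \<noteq> p \<and> dart q (near s q) d \<notin> D" if "i = near s p" for s
      using st that unfolding stable_def by (metis insertCI)
    moreover have "dart p (i - 1) (\<not> d) \<notin> D" if "0 < i"
      using flow[of "i - 1" p "\<not> d"] that assms(2) by auto
    moreover have "dart p (Suc i) (\<not> d) \<notin> D" if "Suc i < len p"
      using flow[of i p d] that by auto
    ultimately show ?N by blast
  next
    assume N: ?N
    show "stable ?E"
      unfolding stable_def
    proof (intro conjI allI impI)
      fix q l e assume l: "Suc l < len q"
      show "\<not> (dart q l e \<in> ?E \<and> dart q (Suc l) (\<not> e) \<in> ?E)"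
        using l N positionD(2)[OF assms(1) l, of e] assms(2) by (cases d; cases e; cases "l = i") auto
    next
      fix s e
      obtain q where q: "dart q (near s q) e \<notin> D" using positionD(3)[OF assms(1)] by blast
      show "\<exists>q. dart q (near s q) e \<notin> ?E"
      proof (cases "dart q (near s q) e = dart p i d")
        case True
        then have "p = q" "i = near s p" "e = d" using assms(2) by auto
        then show ?thesis using N assms(2) by (metis dart_eq_iff insertE near_less)
      qed (use q in blast)
    qed
  qed
  then show ?thesis using legal_move_iff_stable[OF assms(2)] by blast
qed

section \<open>Counting unmarked edges\<close>

definition unmarked :: "(j2k_vertex \<times> j2k_vertex) set \<Rightarrow> (branch \<times> nat) set" where
  "unmarked D = {(p, i). i < len p \<and> (\<forall>d. dart p i d \<notin> D)}"

lemma finite_unmarked [simp]: "finite (unmarked D)"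
proof (rule finite_subset)
  show "unmarked D \<subseteq> (SIGMA p:UNIV. {..<len p})" by (auto simp: unmarked_def)
  show "finite (SIGMA p:UNIV. {..<len p})" by (auto simp: UNIV_branch)
qed

lemma card_unmarked: "card (unmarked D) = (\<Sum>p\<in>UNIV. card {i. i < len p \<and> (\<forall>d. dart p i d \<notin> D)})"
proof -
  have "unmarked D = (SIGMA p:UNIV. {i. i < len p \<and> (\<forall>d. dart p i d \<notin> D)})"
    by (auto simp: unmarked_def)
  then show ?thesis by (simp add: UNIV_branch)
qed

lemma card_unmarked_empty: "card (unmarked {}) = j + k + 2"
  unfolding card_unmarked by (simp add: UNIV_branch)

lemma card_unmarked_insert:
  assumes "legal_move D a"
  shows "card (unmarked D) = Suc (card (unmarked (insert a D)))"
proof -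
  obtain p i d where a: "i < len p" "a = dart p i d" using assms by (rule legal_moveE)
  have "dart p i e \<notin> D" for e
    using assms a by (cases "e = d") (auto simp: legal_move_iff_stable)
  then have "(p, i) \<in> unmarked D" using a by (simp add: unmarked_def)
  moreover have "unmarked (insert a D) = unmarked D - {(p, i)}"
    using a by (auto simp: unmarked_def)
  ultimately show ?thesis by (metis card.remove finite_unmarked)
qed

text \<open>Each \<open>None\<close> is isolated and flips the value, while adjacent defined values
  agree; so the parity of the number of \<open>None\<close> entries decides whether the first and
  last values agree.\<close>

lemma even_card_switches:
  fixes g :: "nat \<Rightarrow> bool option"
  assumes switch: "\<And>i. i \<le> n \<Longrightarrow> g i = None \<Longrightarrow>
      0 < i \<and> (\<exists>z. g (i - 1) = Some z \<and> g (Suc i) = Some (\<not> z))"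
    and same: "\<And>i z z'. i < n \<Longrightarrow> g i = Some z \<Longrightarrow> g (Suc i) = Some z' \<Longrightarrow> z = z'"
    and "g 0 = Some x" "m \<le> n" "g m = Some y"
  shows "even (card {i. i \<le> m \<and> g i = None}) \<longleftrightarrow> x = y"
  using assms(4,5)
proof (induction m arbitrary: y rule: less_induct)
  case (less m)
  show ?case
  proof (cases m)
    case 0
    then have "card {i. i \<le> m \<and> g i = None} = 0" using assms(3) by auto
    then show ?thesis using less.prems assms(3) 0 by (metis even_zero option.inject)
  next
    case (Suc l)
    have *: "{i. i \<le> m \<and> g i = None} = {i. i \<le> l \<and> g i = None}"
      using Suc less.prems by (auto simp: le_Suc_eq)
    show ?thesis
    proof (cases "g l")
      case (Some z)
      then show ?thesis using less same[of l z y] Suc * by auto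
    next
      case None
      \<comment> \<open>The induction jumps over the gap at \<open>l\<close>, which accounts for
        exactly one flip.\<close>
      then obtain z where l: "0 < l" "g (l - 1) = Some z" "g (Suc l) = Some (\<not> z)"
        using switch[of l] less.prems Suc by auto
      then have "{i. i \<le> l \<and> g i = None} = insert l {i. i \<le> l - 1 \<and> g i = None}"
        using None by (cases l) (auto simp: le_Suc_eq)
      then have "card {i. i \<le> m \<and> g i = None} = Suc (card {i. i \<le> l - 1 \<and> g i = None})"
        using l(1) unfolding * by (simp del: One_nat_def) (subst card_insert_disjoint; auto)
      moreover have "even (card {i. i \<le> l - 1 \<and> g i = None}) \<longleftrightarrow> x = z"
        using less.IH[of "l - 1" z] less.prems Suc l by auto
      ultimately show ?thesis using l less.prems(2) Suc by auto
    qed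
  qed
qed

definition majority :: "bool \<Rightarrow> bool \<Rightarrow> (j2k_vertex \<times> j2k_vertex) set \<Rightarrow> bool" where
  "majority s d D \<longleftrightarrow> (\<exists>p q. p \<noteq> q \<and> dart p (near s p) d \<in> D \<and> dart q (near s q) d \<in> D)"

text \<open>
  If the edge at an end of a branch cannot be marked, the other two edges there flow along
  \<open>d\<close>, so that edge behaves as if the vertex imposed the flow \<open>\<not> d\<close> on it.  With this
  convention every unmarked edge switches the flow along the branch.
\<close>

lemma even_unmarked_branch:
  assumes pos: "position D" and maj: "majority True d D" "majority False d D"
    and stuck: "\<nexists>a. legal_move D a"
  shows "even (card {i. i < len p \<and> (\<forall>e. dart p i e \<notin> D)}) \<longleftrightarrow>
    (dart p (near True p) d \<in> D \<longleftrightarrow> dart p (near False p) d \<in> D)"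
proof -
  define st where "st i = (if dart p i d \<in> D then Some True
     else if dart p i (\<not> d) \<in> D then Some False else None)" for i
  \<comment> \<open>Edge \<open>i\<close> sits at index \<open>i + 1\<close>. The fictitious entries
    0 and \<open>len p + 1\<close> copy the flow of a marked end edge and are
    \<open>Some False\<close> next to an unmarked one.\<close>
  define g where "g i = (if i = 0 then Some (dart p 0 d \<in> D)
     else if i = Suc (len p) then Some (dart p (len p - 1) d \<in> D) else st (i - 1))" for i
  have maj': "majority s d D" for s using maj by (cases s) auto
  have third: "\<exists>q. q \<noteq> p \<and> dart q (near s q) d \<in> D" for s
    using maj'[of s] unfolding majority_def by metis
  have none: "st i = None \<longleftrightarrow> (\<forall>e. dart p i e \<notin> D)" for i
    unfolding st_def by (cases d) (auto simp: all_bool_eq)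
  have some: "st i = Some b \<longleftrightarrow> dart p i (b = d) \<in> D" if "i < len p" for i b
    using positionD(1)[OF pos that, of True] unfolding st_def by (cases d; cases b) auto
  have switch: "0 < i \<and> (\<exists>z. g (i - 1) = Some z \<and> g (Suc i) = Some (\<not> z))"
    if i: "i \<le> Suc (len p)" "g i = None" for i
  proof -
    obtain l where l: "i = Suc l" "l < len p" "st l = None"
      using i by (cases i) (auto simp: g_def split: if_splits)
    have un: "dart p l e \<notin> D" for e using l none by blast
    have no: "\<not> legal_move D (dart p l e)" for e using stuck by blast
    \<comment> \<open>A second branch flows along \<open>d\<close> at each end, so marking against
      \<open>d\<close> never fills up an end. In \<open>A\<close> the obstacle is thus a
      neighbouring edge, whereas in \<open>B\<close> it may also be the end itself.\<close>
    have other: "\<exists>q. q \<noteq> p \<and> dart q (near s q) (\<not> d) \<notin> D" for s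
      using third[of s] positionD(1)[OF pos] near_less by blast
    have A: "(Suc l < len p \<and> dart p (Suc l) d \<in> D) \<or> (0 < l \<and> dart p (l - 1) d \<in> D)"
      using no[of "\<not> d"] un other unfolding legal_move_iff[OF pos l(2)] by auto
    have B: "(Suc l < len p \<and> dart p (Suc l) (\<not> d) \<in> D) \<or> (0 < l \<and> dart p (l - 1) (\<not> d) \<in> D)
        \<or> l = 0 \<or> Suc l = len p"
      using no[of d] un unfolding legal_move_iff[OF pos l(2)] near_conv[OF l(2)]
      by (auto split: if_splits)
    have R: "g (Suc i) = (if Suc l < len p then st (Suc l) else Some False)"
    proof (cases "Suc l < len p")
      case False
      then have "len p = Suc l" using l(2) by simp
      then show ?thesis using l(1) un[of d] by (simp add: g_def)
    qed (use l(1) in \<open>simp add: g_def\<close>)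
    have L: "g (i - 1) = (if 0 < l then st (l - 1) else Some False)"
      using l un by (auto simp: g_def)
    have anti: "\<not> (dart p m d \<in> D \<and> dart p m (\<not> d) \<in> D)" if "m < len p" for m
      using positionD(1)[OF pos that] by blast
    show ?thesis
      using A B anti[of "Suc l"] anti[of "l - 1"] l(1,2) less_imp_diff_less[OF l(2), of 1]
      unfolding R L
      by (auto simp: st_def)
  qed
  have same: "z = z'" if g: "i < Suc (len p)" "g i = Some z" "g (Suc i) = Some z'" for i z z'
  proof -
    consider "i = 0" | "i = len p" "0 < i" | l where "i = Suc l" "Suc l < len p"
      using g(1) by (cases i; cases "i = len p"; force)
    then show ?thesis
    proof cases
      case 1
      then show ?thesis using g by (auto simp: g_def st_def split: if_splits)
    next
      case 2
      then show ?thesis using g by (auto simp: g_def st_def split: if_splits)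
    next
      case 3
      then have "dart p l (z = d) \<in> D" "dart p (Suc l) (z' = d) \<in> D"
        using g some by (auto simp: g_def)
      then show ?thesis using positionD(2)[OF pos 3(2), of "z = d"] by (cases z; cases z') auto
    qed
  qed
  have "bij_betw Suc {i. i < len p \<and> (\<forall>e. dart p i e \<notin> D)} {i. i \<le> Suc (len p) \<and> g i = None}"
    by (rule bij_betwI[where g = "\<lambda>i. i - 1"]) (auto simp: g_def none split: if_splits)
  then have "card {i. i < len p \<and> (\<forall>e. dart p i e \<notin> D)} = card {i. i \<le> Suc (len p) \<and> g i = None}"
    by (rule bij_betw_same_card)
  moreover have "even (card {i. i \<le> Suc (len p) \<and> g i = None}) \<longleftrightarrow>
      (dart p 0 d \<in> D) = (dart p (len p - 1) d \<in> D)"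
    by (rule even_card_switches[where g = g and n = "Suc (len p)"])
      (use switch same in \<open>auto simp: g_def\<close>)
  ultimately show ?thesis by (simp add: near_def)
qed

text \<open>By majority and stability exactly one branch fails to flow along \<open>d\<close> at
  each end. If it is the same branch at both ends, all three counts are even; otherwise exactly two
  are odd.\<close>

lemma even_unmarked_stuck:
  assumes "position D" "majority True d D" "majority False d D" "\<nexists>a. legal_move D a"
  shows "even (card (unmarked D))"
proof -
  have maj: "majority s d D" for s using assms by (cases s) auto
  have two: "let a = \<lambda>p. dart p (near s p) d \<in> D in
      (a Upper \<and> a Middle \<and> \<not> a Lower) \<or> (a Upper \<and> \<not> a Middle \<and> a Lower) \<or>
      (\<not> a Upper \<and> a Middle \<and> a Lower)" for s
    using maj[of s] positionD(3)[OF assms(1), of s d]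
    unfolding majority_def ex_branch Let_def by auto
  show ?thesis
    unfolding card_unmarked
    using two[of True] two[of False] even_unmarked_branch[OF assms, of Upper]
      even_unmarked_branch[OF assms, of Middle] even_unmarked_branch[OF assms, of Lower]
    unfolding UNIV_branch Let_def by (simp del: len.simps) argo
qed

end


section \<open>The strategy of the favoured player\<close>

context j2k_game
begin

definition mid_flow :: "bool \<Rightarrow> (j2k_vertex \<times> j2k_vertex) set \<Rightarrow> bool" where
  "mid_flow d D \<longleftrightarrow> dart Middle 0 d \<in> D \<or> dart Middle 1 d \<in> D"

definition secured :: "bool \<Rightarrow> bool \<Rightarrow> (j2k_vertex \<times> j2k_vertex) set \<Rightarrow> bool" where
  "secured s d D \<longleftrightarrow> (\<exists>p. p \<noteq> Middle \<and> dart p (near s p) d \<in> D)"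

text \<open>A condition that no later move can destroy and that yields majorities along
  \<open>d\<close> at both ends once the position is stuck.\<close>

definition settled :: "bool \<Rightarrow> (j2k_vertex \<times> j2k_vertex) set \<Rightarrow> bool" where
  "settled d D \<longleftrightarrow> mid_flow d D \<and> secured True d D \<and> secured False d D"

lemma mid_flow_mono: "mid_flow d D \<Longrightarrow> D \<subseteq> D' \<Longrightarrow> mid_flow d D'"
  unfolding mid_flow_def by blast

lemma secured_mono: "secured s d D \<Longrightarrow> D \<subseteq> D' \<Longrightarrow> secured s d D'"
  unfolding secured_def by blast

lemma settled_mono: "settled d D \<Longrightarrow> D \<subseteq> D' \<Longrightarrow> settled d D'"
  unfolding settled_def using mid_flow_mono secured_mono by blast

lemma settled_secured: "settled d D \<Longrightarrow> secured s d D"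
  by (cases s) (auto simp: settled_def)

text \<open>The two middle edges meet at \<open>Mid\<close>, where opposite flows would make a sink
  or a source.\<close>

lemma mid_flow_blocks:
  assumes "position D" "mid_flow d D" "i < 2"
  shows "dart Middle i (\<not> d) \<notin> D"
proof -
  have "i = 0 \<or> i = 1" using assms(3) by auto
  then show ?thesis
    using assms(2) positionD(1)[OF assms(1), of 0 Middle d] positionD(1)[OF assms(1), of 1 Middle d]
      positionD(2)[OF assms(1), of 0 Middle d] positionD(2)[OF assms(1), of 0 Middle "\<not> d"]
    by (auto simp: mid_flow_def)
qed

text \<open>
  An unmarked middle edge at the end \<open>s\<close> could only be marked along \<open>d\<close>, and this is
  impossible only if both other edges at that end already flow along \<open>d\<close>.
\<close>

lemma stuck_majority:
  assumes pos: "position D" and "mid_flow d D" "secured s d D" "\<nexists>a. legal_move D a"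
  shows "majority s d D"
proof (cases "dart Middle (near s Middle) d \<in> D")
  case True
  then show ?thesis using assms(3) unfolding majority_def secured_def by blast
next
  case False
  let ?n = "near s Middle"
  have n: "?n < len Middle" "?n < 2" using near_less[of s Middle] by simp_all
  have "dart Middle i (\<not> d) \<notin> D" if "i < 2" for i
    using mid_flow_blocks assms(1,2) that by blast
  moreover have "\<not> legal_move D (dart Middle ?n d)" using assms(4) by blast
  ultimately obtain t where t: "?n = near t Middle" "\<And>q. q \<noteq> Middle \<Longrightarrow> dart q (near t q) d \<in> D"
    using False n unfolding legal_move_iff[OF pos n(1)] by (auto simp: less_imp_diff_less)
  then have "t = s" by (auto simp: near_def split: if_splits)
  then show ?thesis unfolding majority_def using t(2)[of Upper] t(2)[of Lower] by blast
qed

lemma settled_odd_not_stuck: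
  assumes "position D" "settled d D" "odd (card (unmarked D))"
  shows "\<exists>a. legal_move D a"
  using even_unmarked_stuck[OF assms(1), of d] stuck_majority[OF assms(1), of d] assms(2,3)
  unfolding settled_def by blast

text \<open>The middle edges of the cell flow along \<open>\<not> e\<close>, hence
  \<open>\<not> e = d\<close>. The outer branch of the cell then flows against \<open>d\<close>, so
  the edge securing an end lies on the other outer branch.\<close>

lemma settled_cell:
  assumes "position D" "settled d D" "p \<noteq> Middle" "cell_arcs p e \<subseteq> D"
  shows "e = (\<not> d)" "\<exists>q. q \<noteq> Middle \<and> q \<noteq> p \<and> dart q (near s q) d \<in> D"
proof -
  have "dart Middle 0 (\<not> e) \<in> D" using assms(4) by (simp add: cell_arcs_def)
  then show e: "e = (\<not> d)"
    using mid_flow_blocks[OF assms(1), of d 0] assms(2) by (cases e; cases d) (auto simp: settled_def)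
  obtain q where q: "q \<noteq> Middle" "dart q (near s q) d \<in> D"
    using settled_secured[OF assms(2), of s] unfolding secured_def by blast
  have "dart p (near s p) e \<in> D" using assms(4) near_less unfolding cell_arcs_def by blast
  then have "q \<noteq> p" using q(2) positionD(1)[OF assms(1), of "near s p" p d] e by auto
  then show "\<exists>q. q \<noteq> Middle \<and> q \<noteq> p \<and> dart q (near s q) d \<in> D" using q by blast
qed

text \<open>An outer branch with an end edge along \<open>d\<close> can never flow entirely against
  \<open>d\<close>, which leaves one cell in one sense. Only the existence of a fixed arc set
  \<open>C\<close> is needed later.\<close>

lemma settled_one_cell:
  assumes "position D" "settled d D"
  shows "\<exists>C. \<forall>D'. position D' \<longrightarrow> D \<subseteq> D' \<longrightarrow> (cell_completed D' \<longleftrightarrow> C \<subseteq> D')"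
proof -
  obtain q where q: "q \<noteq> Middle" "dart q (near True q) d \<in> D"
    using assms(2) unfolding settled_def secured_def by blast
  define p where "p = (if q = Upper then Lower else Upper)"
  have p: "p \<noteq> Middle" "\<And>r. r \<noteq> Middle \<Longrightarrow> r \<noteq> q \<Longrightarrow> r = p"
    using q(1) by (auto simp: p_def) (metis branch.exhaust)+
  have "cell_completed D' \<longleftrightarrow> cell_arcs p (\<not> d) \<subseteq> D'" if D': "position D'" "D \<subseteq> D'" for D'
  proof
    assume "cell_completed D'"
    then obtain r e where r: "r \<noteq> Middle" "cell_arcs r e \<subseteq> D'" by (auto simp: cell_completed_iff)
    have "e = (\<not> d)" using settled_cell(1)[OF D'(1) settled_mono[OF assms(2) D'(2)] r] .
    moreover have "dart r (near True r) e \<in> D'" using r(2) near_less unfolding cell_arcs_def by blast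
    ultimately have "r \<noteq> q"
      using q(2) D'(2) positionD(1)[OF D'(1), of "near True q" q d] by auto
    then show "cell_arcs p (\<not> d) \<subseteq> D'" using p r \<open>e = (\<not> d)\<close> by blast
  qed (use p(1) in \<open>auto simp: cell_completed_iff\<close>)
  then show ?thesis by blast
qed

section \<open>Safe moves in settled positions\<close>

definition safe :: "(j2k_vertex \<times> j2k_vertex) set \<Rightarrow> bool" where
  "safe D \<longleftrightarrow> (\<forall>a. legal_move D a \<longrightarrow> \<not> cell_completed (insert a D))"

text \<open>
  If a legal move \<open>a\<close> lets the opponent complete the cell by \<open>b\<close>, then by parity some
  further move \<open>g\<close> is legal even after both of them.  If \<open>g\<close> were answered by a completion
  as well, the cell would lack a single edge already now.
\<close>

lemma settled_move:
  assumes pos: "position D" and settled: "settled d D" and odd: "odd (card (unmarked D))"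
  shows "\<exists>b. legal_move D b \<and> (cell_completed (insert b D) \<or> safe (insert b D))"
proof (rule ccontr)
  assume neg: "\<not> ?thesis"
  obtain C where C: "\<And>D'. position D' \<Longrightarrow> D \<subseteq> D' \<Longrightarrow> cell_completed D' \<longleftrightarrow> C \<subseteq> D'"
    using settled_one_cell[OF pos settled] by blast
  \<comment> \<open>By \<open>neg\<close>, no move completes a cell at once and none is safe, so
    every move has a completing reply.\<close>
  have answer: "\<exists>b. legal_move (insert a D) b \<and> C \<subseteq> insert b (insert a D) \<and> \<not> C \<subseteq> insert a D"
    if a: "legal_move D a" for a
  proof -
    have pa: "position (insert a D)" using position_insert[OF pos a] .
    obtain b where b: "legal_move (insert a D) b" "cell_completed (insert b (insert a D))"
      using neg a unfolding safe_def by blast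
    moreover have "\<not> cell_completed (insert a D)" using neg a by blast
    ultimately show ?thesis
      using C[OF pa] C[OF position_insert[OF pa b(1)]] by blast
  qed
  obtain a where a: "legal_move D a" using settled_odd_not_stuck[OF pos settled odd] by blast
  obtain b where b: "legal_move (insert a D) b" "C \<subseteq> insert b (insert a D)"
    using answer[OF a] by blast
  let ?E = "insert b (insert a D)"
  have "position ?E" using position_insert[OF position_insert[OF pos a] b(1)] .
  moreover have "settled d ?E" using settled by (rule settled_mono) blast
  moreover have "odd (card (unmarked ?E))"
    using odd card_unmarked_insert[OF a] card_unmarked_insert[OF b(1)] by simp
  ultimately obtain g where g: "legal_move ?E g" using settled_odd_not_stuck by blast
  have "legal_move D g" by (rule legal_move_antimono[OF g]) blast
  then obtain h where h: "legal_move (insert g D) h" "C \<subseteq> insert h (insert g D)"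
    "\<not> C \<subseteq> insert g D" using answer by blast
  \<comment> \<open>\<open>C\<close> is contained in \<open>?E\<close>, so \<open>g\<close> is not
    in \<open>C\<close>; hence \<open>h\<close> alone supplies what is missing from
    \<open>C\<close>.\<close>
  have "g \<notin> ?E" using g by (simp add: legal_move_def)
  then have "C \<subseteq> insert h D" using b(2) h(2) by blast
  moreover have lh: "legal_move D h" by (rule legal_move_antimono[OF h(1)]) blast
  ultimately have "cell_completed (insert h D)" using C[OF position_insert[OF pos lh]] by blast
  then show False using neg lh by blast
qed

text \<open>A cell has at least six edges, but at most five of the \<open>j + k + 2\<close> edges
  are marked.\<close>

lemma not_completed_if_many_unmarked:
  assumes "j + k - 3 \<le> card (unmarked D)"
  shows "\<not> cell_completed D"
proof
  assume "cell_completed D"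
  then obtain p e where p: "p \<noteq> Middle" "cell_arcs p e \<subseteq> D" by (auto simp: cell_completed_iff)
  define q where "q = (if p = Upper then Lower else Upper)"
  have len: "len p + len q = j + k" using p(1) by (cases p) (auto simp: q_def)
  have "unmarked D \<subseteq> {q} \<times> {..<len q}"
  proof
    fix x assume x: "x \<in> unmarked D"
    obtain r i where ri: "x = (r, i)" "i < len r" "\<And>f. dart r i f \<notin> D"
      using x unfolding unmarked_def by blast
    have "r \<noteq> p" using p(2) ri(2,3) unfolding cell_arcs_def by blast
    moreover have "r \<noteq> Middle"
    proof
      assume "r = Middle"
      then have "i = 0 \<or> i = 1" using ri(2) by auto
      then show False using p(2) ri(3) \<open>r = Middle\<close> unfolding cell_arcs_def by blast
    qed
    ultimately have "r = q" using p(1) by (cases r; cases p) (auto simp: q_def)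
    then show "x \<in> {q} \<times> {..<len q}" using ri by simp
  qed
  then have "card (unmarked D) \<le> card ({q} \<times> {..<len q})" by (intro card_mono) auto
  then show False using assms len len_ge(2)[OF p(1)] by simp
qed

text \<open>
  A cell completed by one move avoids the edges that secure the two ends, so those are marked
  in addition to the at least six edges of the cell.
\<close>

lemma settled_safe:
  assumes pos: "position D" and settled: "settled d D" and "j + k - 4 \<le> card (unmarked D)"
  shows "safe D"
  unfolding safe_def
proof (intro allI impI notI)
  fix a assume a: "legal_move D a" and "cell_completed (insert a D)"
  let ?E = "insert a D"
  obtain p e where p: "p \<noteq> Middle" "cell_arcs p e \<subseteq> ?E"
    using \<open>cell_completed ?E\<close> by (auto simp: cell_completed_iff)
  define q where "q = (if p = Upper then Lower else Upper)"
  have q: "r = q" if "r \<noteq> Middle" "r \<noteq> p" for r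
    using that p(1) by (cases r; cases p) (auto simp: q_def)
  have len: "len p + len q = j + k" "4 \<le> len p" "4 \<le> len q"
    using p(1) j4 k4 by (cases p; simp add: q_def)+
  have "settled d ?E" using settled by (rule settled_mono) blast
  then have sec: "dart q (near s q) d \<in> ?E" for s
    using settled_cell(2)[OF position_insert[OF pos a] _ p] q by blast
  have "unmarked ?E \<subseteq> {q} \<times> {1..<len q - 1}"
  proof
    fix x assume x: "x \<in> unmarked ?E"
    obtain r i where ri: "x = (r, i)" "i < len r" "\<And>f. dart r i f \<notin> ?E"
      using x unfolding unmarked_def by blast
    have "r \<noteq> p" using p(2) ri(2,3) unfolding cell_arcs_def by blast
    moreover have "r \<noteq> Middle"
    proof
      assume "r = Middle"
      then have "i = 0 \<or> i = 1" using ri(2) by auto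
      then show False using p(2) ri(3) \<open>r = Middle\<close> unfolding cell_arcs_def by blast
    qed
    ultimately have r: "r = q" by (rule q[rotated])
    have "i \<noteq> near s q" for s using sec[of s] ri(3)[of d] r by blast
    from this[of True] this[of False] have "i \<noteq> 0" "i \<noteq> len q - 1" by (simp_all add: near_def)
    then show "x \<in> {q} \<times> {1..<len q - 1}" using ri r by auto
  qed
  \<comment> \<open>At most \<open>len q - 2\<close>, hence at most \<open>j + k - 6\<close>, edges
    are left, while the hypothesis leaves at least \<open>j + k - 5\<close> after the move
    \<open>a\<close>.\<close>
  then have "card (unmarked ?E) \<le> card ({q} \<times> {1..<len q - 1})" by (intro card_mono) auto
  then show False using assms(3) card_unmarked_insert[OF a] len by simp
qed

section \<open>Securing the two ends\<close>

definition available :: "bool \<Rightarrow> bool \<Rightarrow> branch \<Rightarrow> (j2k_vertex \<times> j2k_vertex) set \<Rightarrow> bool" where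
  "available s d p D \<longleftrightarrow> dart p (near s p) (\<not> d) \<notin> D \<and> dart p (second s p) (\<not> d) \<notin> D"

lemma available_insert:
  assumes "available s d p D" "i < len q" "q = p \<Longrightarrow> e = (\<not> d) \<Longrightarrow> i \<noteq> near s p \<and> i \<noteq> second s p"
  shows "available s d p (insert (dart q i e) D)"
  using assms unfolding available_def by auto

text \<open>Availability means that neither the end edge nor its neighbour on \<open>p\<close> flows
  against \<open>d\<close>. As the end is not secured, the other outer branch does not flow along
  \<open>d\<close> there, so the new mark cannot fill up the end.\<close>

lemma legal_secure:
  assumes pos: "position D" and p: "p \<noteq> Middle" "available s d p D" and n: "\<not> secured s d D"
  shows "legal_move D (dart p (near s p) d)" "secured s d (insert (dart p (near s p) d) D)"
proof -
  define q where "q = (if p = Upper then Lower else Upper)"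
  have q: "q \<noteq> p" "q \<noteq> Middle" using p(1) by (auto simp: q_def)
  have "dart p (near s p) d \<notin> D" "dart q (near s q) d \<notin> D"
    using n p(1) q(2) by (auto simp: secured_def)
  moreover have "t = s" if "near s p = near t p" for t
    using that len_ge(1)[of p] by (cases s; cases t) (auto simp: near_def)
  moreover have "Suc (near s p) < len p \<Longrightarrow> Suc (near s p) = second s p"
    "0 < near s p \<Longrightarrow> near s p - 1 = second s p"
    by (auto simp: near_def second_def)
  ultimately show "legal_move D (dart p (near s p) d)"
    using p(2) q(1) unfolding legal_move_iff[OF pos near_less] available_def by auto
  show "secured s d (insert (dart p (near s p) d) D)" using p(1) by (auto simp: secured_def)
qed

text \<open>
  The positions that the favoured player leaves to the opponent.  The lower bounds on the
  number of unmarked edges count the moves made so far.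
\<close>

definition winning :: "(j2k_vertex \<times> j2k_vertex) set set" where
  "winning = {D. position D \<and> even (card (unmarked D)) \<and> (\<exists>d. mid_flow d D \<and>
     ((\<forall>s p. p \<noteq> Middle \<longrightarrow> available s d p D) \<and> j + k \<le> card (unmarked D) \<or>
      (\<exists>s. secured s d D \<and> (\<forall>p. p \<noteq> Middle \<longrightarrow> available (\<not> s) d p D) \<and>
         j + k - 2 \<le> card (unmarked D)) \<or>
      settled d D \<and> safe D))}"

lemma winningI:
  assumes "position D" "even (card (unmarked D))" "mid_flow d D"
  shows "(\<And>s p. p \<noteq> Middle \<Longrightarrow> available s d p D) \<Longrightarrow> j + k \<le> card (unmarked D) \<Longrightarrow> D \<in> winning"
    and "secured s d D \<Longrightarrow> (\<And>p. p \<noteq> Middle \<Longrightarrow> available (\<not> s) d p D) \<Longrightarrow>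
      j + k - 2 \<le> card (unmarked D) \<Longrightarrow> D \<in> winning"
    and "settled d D \<Longrightarrow> safe D \<Longrightarrow> D \<in> winning"
  using assms unfolding winning_def by blast+

text \<open>The favoured player is to move with end \<open>s\<close> secured. If the other end is
  secured too, \<open>settled_move\<close> applies by parity; otherwise it is secured on branch
  \<open>p\<close>.\<close>

lemma winning_settle:
  assumes pos: "position D" and odd: "odd (card (unmarked D))" and "mid_flow d D" "secured s d D"
    and p: "p \<noteq> Middle" "secured (\<not> s) d D \<or> available (\<not> s) d p D"
    and card: "j + k - 3 \<le> card (unmarked D)"
  shows "\<exists>b. legal_move D b \<and> (cell_completed (insert b D) \<or> insert b D \<in> winning)"
proof (cases "secured (\<not> s) d D")
  case True
  then have st: "settled d D" using assms(3,4) by (cases s) (auto simp: settled_def)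
  obtain b where b: "legal_move D b" "cell_completed (insert b D) \<or> safe (insert b D)"
    using settled_move[OF pos st odd] by blast
  have "settled d (insert b D)" using st by (rule settled_mono) blast
  then have "insert b D \<in> winning" if "safe (insert b D)"
    using that position_insert[OF pos b(1)] card_unmarked_insert[OF b(1)] odd
    unfolding winning_def by (auto simp: settled_def)
  then show ?thesis using b by blast
next
  case False
  then have "available (\<not> s) d p D" using p(2) by blast
  note b = legal_secure[OF pos p(1) this False]
  let ?E = "insert (dart p (near (\<not> s) p) d) D"
  have "secured s d ?E" "mid_flow d ?E"
    using secured_mono[OF assms(4)] mid_flow_mono[OF assms(3)] by blast+
  then have st: "settled d ?E" using b(2) by (cases s) (auto simp: settled_def)
  have pE: "position ?E" using position_insert[OF pos b(1)] .
  \<comment> \<open>One more mark leaves at least \<open>j + k - 4\<close> unmarked edges, the exact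
    bound of \<open>settled_safe\<close>.\<close>
  have "safe ?E"
    using settled_safe[OF pE st] card card_unmarked_insert[OF b(1)] by simp
  then have "?E \<in> winning"
    using pE st card_unmarked_insert[OF b(1)] odd unfolding winning_def
    by (auto simp: settled_def)
  then show ?thesis using b(1) by blast
qed

text \<open>One case for each phase of \<open>winning\<close>: no end, one end or both ends known to
  be secured.\<close>

lemma winning_step:
  assumes D: "D \<in> winning" and a: "legal_move D a"
  shows "\<not> cell_completed (insert a D) \<and> (\<exists>b. legal_move (insert a D) b \<and>
    (cell_completed (insert b (insert a D)) \<or> insert b (insert a D) \<in> winning))"
proof -
  let ?E = "insert a D"
  obtain d where pos: "position D" and ev: "even (card (unmarked D))" and mid: "mid_flow d D"
    and phase: "(\<forall>s p. p \<noteq> Middle \<longrightarrow> available s d p D) \<and> j + k \<le> card (unmarked D) \<or>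
      (\<exists>s. secured s d D \<and> (\<forall>p. p \<noteq> Middle \<longrightarrow> available (\<not> s) d p D) \<and>
         j + k - 2 \<le> card (unmarked D)) \<or> settled d D \<and> safe D"
    using D unfolding winning_def by blast
  have posE: "position ?E" using position_insert[OF pos a] .
  have cardE: "card (unmarked D) = Suc (card (unmarked ?E))" using card_unmarked_insert[OF a] .
  have oddE: "odd (card (unmarked ?E))" using ev cardE by simp
  have midE: "mid_flow d ?E" using mid by (rule mid_flow_mono) blast
  obtain q i e where q: "i < len q" "a = dart q i e" using a by (rule legal_moveE)
  \<comment> \<open>An outer branch not touched by the opponent's move.\<close>
  define p where "p = (if q = Upper then Lower else Upper)"
  have p: "p \<noteq> Middle" "q \<noteq> p" by (auto simp: p_def)
  from phase show ?thesis
  proof (elim disjE conjE exE)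
    assume av: "\<forall>s p. p \<noteq> Middle \<longrightarrow> available s d p D" and c: "j + k \<le> card (unmarked D)"
    have nc: "\<not> cell_completed ?E" using c cardE by (intro not_completed_if_many_unmarked) simp
    \<comment> \<open>\<open>s\<close> is the threatened end. An outer branch has at least four
      edges, so the two edges relevant at the left end and the two at the right end are
      disjoint.\<close>
    obtain s where s: "q = Middle \<or> (i \<noteq> near (\<not> s) q \<and> i \<noteq> second (\<not> s) q)"
    proof (cases "q = Middle")
      case False
      then have "4 \<le> len q" by (rule len_ge(2))
      then show ?thesis
        by (cases "i < 2"; intro that[of "i < 2"]) (auto simp: near_def second_def)
    qed (use that in blast)
    have far: "available (\<not> s) d r ?E" if "r \<noteq> Middle" for r
      unfolding q(2) using av that s q(1) by (intro available_insert) auto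
    have near: "available s d p ?E"
      unfolding q(2) using av p q(1) by (intro available_insert) auto
    show ?thesis
    proof (cases "secured s d ?E")
      \<comment> \<open>The opponent's own move may have secured the end \<open>s\<close>; then the
        other end comes next.\<close>
      case True
      then show ?thesis
        using winning_settle[OF posE oddE midE True p(1)] far[OF p(1)] c cardE nc by simp
    next
      case False
      \<comment> \<open>The threatened end is secured first; the far end keeps both of its
        candidates.\<close>
      note b = legal_secure[OF posE p(1) near False]
      let ?F = "insert (dart p (near s p) d) ?E"
      have "available (\<not> s) d r ?F" if "r \<noteq> Middle" for r
        using far[OF that] by (rule available_insert) auto
      moreover have "mid_flow d ?F" using midE by (rule mid_flow_mono) blast
      moreover have "card (unmarked ?E) = Suc (card (unmarked ?F))"
        using card_unmarked_insert[OF b(1)] .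
      ultimately have "?F \<in> winning"
        using position_insert[OF posE b(1)] b(2) oddE c cardE by (intro winningI(2)) auto
      then show ?thesis using b(1) nc by blast
    qed
  next
    fix s assume s: "secured s d D" "\<forall>p. p \<noteq> Middle \<longrightarrow> available (\<not> s) d p D"
      and c: "j + k - 2 \<le> card (unmarked D)"
    have nc: "\<not> cell_completed ?E" using c cardE by (intro not_completed_if_many_unmarked) simp
    have "available (\<not> s) d p ?E"
      unfolding q(2) using s(2) p q(1) by (intro available_insert) auto
    moreover have "secured s d ?E" using s(1) by (rule secured_mono) blast
    ultimately show ?thesis
      using winning_settle[OF posE oddE midE _ p(1)] c cardE nc by simp
  next
    assume st: "settled d D" "safe D"
    have nc: "\<not> cell_completed ?E" using st(2) a unfolding safe_def by blast
    have "settled d ?E" using st(1) by (rule settled_mono) blast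
    then obtain b where b: "legal_move ?E b" "cell_completed (insert b ?E) \<or> safe (insert b ?E)"
      using settled_move[OF posE _ oddE] by blast
    have "settled d (insert b ?E)" using st(1) by (rule settled_mono) blast
    then have "insert b ?E \<in> winning" if "safe (insert b ?E)"
      using that position_insert[OF posE b(1)] card_unmarked_insert[OF b(1)] oddE
      unfolding winning_def by (auto simp: settled_def)
    then show ?thesis using b nc by blast
  qed
qed

section \<open>The opening moves\<close>

lemma legal_move_first:
  assumes "i < len p"
  shows "legal_move {} (dart p i d)"
  using assms unfolding legal_move_iff[OF position_empty assms] by (cases p) auto

text \<open>One middle mark touches no outer branch and leaves \<open>j + k + 1\<close> unmarked
  edges, an even number.\<close>

lemma winning_opening:
  assumes "odd (j + k)"
  shows "{dart Middle 0 True} \<in> winning"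
proof -
  have leg: "legal_move {} (dart Middle 0 True)" by (rule legal_move_first) simp
  have "available s True p {dart Middle 0 True}" if "p \<noteq> Middle" for s p
    using that by (auto simp: available_def)
  then show ?thesis
    using position_insert[OF position_empty leg] card_unmarked_insert[OF leg, symmetric] assms
    unfolding winning_def by (auto simp: card_unmarked_empty mid_flow_def)
qed

text \<open>The flow \<open>d\<close> is taken from the opponent's first mark, which therefore
  spoils no candidate; the reply is a middle edge along the same flow.\<close>

lemma winning_reply:
  assumes "even (j + k)" "legal_move {} a"
  shows "\<not> cell_completed {a} \<and> (\<exists>b. legal_move {a} b \<and> insert b {a} \<in> winning)"
proof -
  obtain q i d where a: "i < len q" "a = dart q i d" using assms(2) by (rule legal_moveE)
  have pos: "position {a}" using position_insert[OF position_empty assms(2)] .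
  have card: "card (unmarked {a}) = j + k + 1"
    using card_unmarked_insert[OF assms(2)] by (simp add: card_unmarked_empty)
  \<comment> \<open>If the first mark is on the middle path, the reply takes the other middle
    edge.\<close>
  define m where "m = (if q = Middle then 1 - i else 0)"
  have m: "m < len Middle" "q = Middle \<Longrightarrow> m \<noteq> i" using a(1) by (auto simp: m_def) arith
  let ?b = "dart Middle m d"
  have leg: "legal_move {a} ?b"
  proof -
    have "\<exists>r. r \<noteq> Middle \<and> dart r (near s r) d \<noteq> dart q i d" for s
      using a(1) by (intro exI[of _ "if q = Upper then Lower else Upper"]) auto
    then show ?thesis using a(1) m unfolding legal_move_iff[OF pos m(1)] unfolding a(2) by auto
  qed
  have "available s d p (insert ?b {a})" for s p
    using a m by (auto simp: available_def)
  moreover have "mid_flow d (insert ?b {a})"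
    using m(1) by (auto simp: mid_flow_def less_Suc_eq numeral_2_eq_2)
  moreover have "card (unmarked (insert ?b {a})) = j + k"
    using card_unmarked_insert[OF leg] card by simp
  ultimately have "insert ?b {a} \<in> winning"
    using position_insert[OF pos leg] assms(1) unfolding winning_def by auto
  moreover have "\<not> cell_completed {a}" using card by (intro not_completed_if_many_unmarked) simp
  ultimately show ?thesis using leg by blast
qed

lemma not_completed_empty: "\<not> cell_completed {}"
  by (rule not_completed_if_many_unmarked) (simp add: card_unmarked_empty)

theorem player1_wins:
  assumes "odd (j + k)"
  shows "has_winning_strategy Player1"
proof (rule winning_strategy_from_invariant[where I = winning])
  show "\<not> cell_completed {} \<and> (\<exists>a. legal_move {} a \<and> {a} \<in> winning)"
    using not_completed_empty winning_opening[OF assms] legal_move_first[OF len_pos] by blast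
qed (use winning_step in simp_all)

text \<open>The empty board has no marked middle edge and so is not in \<open>winning\<close>; it is
  added to the invariant and answered by \<open>winning_reply\<close>.\<close>

theorem player2_wins:
  assumes "even (j + k)"
  shows "has_winning_strategy Player2"
proof (rule winning_strategy_from_invariant[where I = "insert {} winning"])
  show "\<not> game_over {} \<and> {} \<in> insert {} winning"
    using not_completed_empty legal_move_first[OF len_pos]
    unfolding game_over_def by blast
  show "\<not> cell_completed (insert a D) \<and> (\<exists>b. legal_move (insert a D) b \<and>
      (cell_completed (insert b (insert a D)) \<or> insert b (insert a D) \<in> insert {} winning))"
    if "D \<in> insert {} winning" "legal_move D a" for D a
  proof (cases "D \<in> winning")
    case True
    then show ?thesis using winning_step that(2) by blast
  next
    case False
    then have "D = {}" using that(1) by blast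
    then show ?thesis using winning_reply[OF assms] that(2) by blast
  qed
qed simp

end

theorem theorem2:
  fixes j k :: nat
  assumes "j \<ge> 4" and "k \<ge> 4"
  shows "(odd (j + k) \<longrightarrow>
            gameboard.has_winning_strategy (j2k_graph j k) (j2k_cells j k) Player1) \<and>
         (even (j + k) \<longrightarrow>
            gameboard.has_winning_strategy (j2k_graph j k) (j2k_cells j k) Player2)"
proof -
  interpret j2k_game j k using assms by unfold_locales
  show ?thesis using player1_wins player2_wins by blast
qed

end
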